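(* The function $(1^n\,0\,1^k)\mapsto E(n,k)$ is in $\#\mathsf{L}$. In particular, computing the Euler numbers $E_n=E(n,n)$, that is, the function $(1^n)\mapsto E_n$, is in $\#\mathsf{L}$.
   Context: The Euler number $E_n=\#\{w\in S_n : w_1>w_2<w_3>\cdots\}$ counts zigzag (alternating) permutations. The Entringer number is $E(n,k)=\#\{w\in S_{n+1} : k+1=w_1>w_2<w_3>\cdots\}$; in particular $E(1,1)=1$, $E(1,0)=0$, and $E(n,0)=0$ for $n>1$. The alphabet is $\Sigma=\{0,1\}$; $1^a$ is the string of $a$ ones and juxtaposition is concatenation. A function given only on strings of a displayed form is extended by $0$ to all other strings. $\#\mathsf{L}$ is the class of functions $f:\Sigma^*\to\mathbb{N}_0$ such that $f(x)$ is the number of accepting computation paths on input $x$ of a fixed nondeterministic Turing machine with read-only input tape that uses $O(\log|x|)$ work space and halts on every computation path. Equivalently: there are a polynomial $q$ and a deterministic $O(\log|x|)$-space Turing machine $M$ with an additional read-once, left-to-right witness tape such that $f(x)=\#\{w\in\Sigma^{q(|x|)}\mid M(x,w)=\mathsf{yes}\}$. *)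

theory Defs
  imports "HOL-Library.Landau_Symbols" "HOL-Combinatorics.Multiset_Permutations"
begin

section \<open>Euler and Entringer numbers\<close>

text \<open>
  A permutation in \<open>S\<^sub>n\<close> is represented by its word \<open>w\<^sub>1 \<dots> w\<^sub>n\<close>, a list in
  \<^term>\<open>permutations_of_set {1..n}\<close>. List indices start at \<open>0\<close>, so \<open>w\<^sub>i\<close> is \<^term>\<open>w ! (i - 1)\<close>,
  and the descents \<open>w\<^sub>1 > w\<^sub>2\<close>, \<open>w\<^sub>3 > w\<^sub>4\<close>, \<dots> are at the even list indices.
\<close>

definition alternating :: "nat list \<Rightarrow> bool" where
  "alternating w \<longleftrightarrow>
     (\<forall>i. Suc i < length w \<longrightarrow>
        (if even i then w ! i > w ! Suc i else w ! i < w ! Suc i))"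

definition euler_number :: "nat \<Rightarrow> nat" where
  "euler_number n = card {w \<in> permutations_of_set {1..n}. alternating w}"

definition entringer :: "nat \<Rightarrow> nat \<Rightarrow> nat" where
  "entringer n k =
     card {w \<in> permutations_of_set {1..n + 1}. hd w = k + 1 \<and> alternating w}"


section \<open>Nondeterministic Turing machines with a read-only input tape\<close>

text \<open>
  Strings over \<open>{0, 1}\<close> are Boolean lists, with \<^term>\<open>True\<close> for \<open>1\<close>. On input \<open>x\<close> the input tape
  has the cells \<open>0, \<dots>, |x| + 1\<close>; the input is delimited by end markers in the two outermost
  cells. There is one work tape, infinite to the right, with cells \<open>0, 1, 2, \<dots>\<close>.
\<close>

datatype insym = LeftEnd | Bit bool | RightEnd

datatype dir = MoveLeft | Stay | MoveRight

text \<open>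
  A transition \<open>(q, a, b, q', b', d, e)\<close> can be taken in state \<open>q\<close> when the input head reads \<open>a\<close>
  and the work head reads \<open>b\<close>. It changes the state to \<open>q'\<close>, writes \<open>b'\<close> on the work tape,
  and moves the input head in direction \<open>d\<close> and the work head in direction \<open>e\<close>.
\<close>

record ('q, 'a) ntm =
  states :: "'q set"
  symbols :: "'a set"
  blank :: 'a
  start :: 'q
  accept :: "'q set"
  trans_rel :: "('q \<times> insym \<times> 'a \<times> 'q \<times> 'a \<times> dir \<times> dir) set"

definition wf_ntm :: "('q, 'a) ntm \<Rightarrow> bool" where
  "wf_ntm M \<longleftrightarrow>
     finite (states M) \<and> finite (symbols M) \<and>
     blank M \<in> symbols M \<and> start M \<in> states M \<and> accept M \<subseteq> states M \<and>
     trans_rel M \<subseteq>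
       states M \<times> UNIV \<times> symbols M \<times> states M \<times> symbols M \<times> UNIV \<times> UNIV"

datatype ('q, 'a) config =
  Config (state: 'q) (in_pos: nat) (work_tape: "nat \<Rightarrow> 'a") (work_pos: nat)

definition init_config :: "('q, 'a) ntm \<Rightarrow> ('q, 'a) config" where
  "init_config M = Config (start M) 0 (\<lambda>_. blank M) 0"

definition read_input :: "bool list \<Rightarrow> nat \<Rightarrow> insym" where
  "read_input x i =
     (if i = 0 then LeftEnd else if i \<le> length x then Bit (x ! (i - 1)) else RightEnd)"

text \<open>A head stays where it is if it is told to move to the left of cell \<open>0\<close>; likewise for the
  input head at the right end marker.\<close>

fun move :: "dir \<Rightarrow> nat \<Rightarrow> nat" where
  "move MoveLeft p = p - 1"
| "move Stay p = p"
| "move MoveRight p = p + 1"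

inductive step :: "('q, 'a) ntm \<Rightarrow> bool list \<Rightarrow> ('q, 'a) config \<Rightarrow> ('q, 'a) config \<Rightarrow> bool"
  for M :: "('q, 'a) ntm" and x :: "bool list" where
  "(q, read_input x i, t p, q', b, d, e) \<in> trans_rel M \<Longrightarrow>
     step M x (Config q i t p)
              (Config q' (min (length x + 1) (move d i)) (t(p := b)) (move e p))"

definition halted :: "('q, 'a) ntm \<Rightarrow> bool list \<Rightarrow> ('q, 'a) config \<Rightarrow> bool" where
  "halted M x c \<longleftrightarrow> (\<nexists>c'. step M x c c')"

definition halts_on_every_path :: "('q, 'a) ntm \<Rightarrow> bool list \<Rightarrow> bool" where
  "halts_on_every_path M x \<longleftrightarrow>
     (\<nexists>r :: nat \<Rightarrow> ('q, 'a) config. r 0 = init_config M \<and> (\<forall>i. step M x (r i) (r (Suc i))))"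

text \<open>The work space is at most \<open>m\<close> if only the first \<open>m\<close> work cells are ever visited.\<close>

definition work_space_le :: "('q, 'a) ntm \<Rightarrow> bool list \<Rightarrow> nat \<Rightarrow> bool" where
  "work_space_le M x m \<longleftrightarrow> (\<forall>c. (step M x)\<^sup>*\<^sup>* (init_config M) c \<longrightarrow> work_pos c < m)"

text \<open>
  A computation path is the list of the configurations it goes through. For a well-formed machine
  that halts on every path the set of these lists is finite, by the infinity lemma
  for finitely branching trees, so that its cardinality is the true number of accepting paths.
\<close>

definition accepting_paths :: "('q, 'a) ntm \<Rightarrow> bool list \<Rightarrow> ('q, 'a) config list set" where
  "accepting_paths M x =
     {cs. cs \<noteq> [] \<and> hd cs = init_config M \<and> successively (step M x) cs \<and>
          halted M x (last cs) \<and> state (last cs) \<in> accept M}"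


section \<open>The class #L\<close>

text \<open>
  States and work symbols are natural numbers, which is no restriction since both sets are finite.
  The bound \<open>s\<close> has to hold for every input, but \<open>O\<close> constrains it only for large lengths. This
  makes the convention for \<open>log 0\<close> and \<open>log 1\<close> irrelevant.
\<close>

definition sharpL :: "(bool list \<Rightarrow> nat) set" where
  "sharpL =
     {f. \<exists>(M :: (nat, nat) ntm) (s :: nat \<Rightarrow> nat).
           wf_ntm M \<and>
           (\<lambda>n. real (s n)) \<in> O(\<lambda>n. ln (real n)) \<and>
           (\<forall>x. work_space_le M x (s (length x))) \<and>
           (\<forall>x. halts_on_every_path M x) \<and>
           (\<forall>x. f x = card (accepting_paths M x))}"


section \<open>Functions given on strings of a displayed form\<close>

text \<open>\<open>extend_zero enc g\<close> is the function \<open>enc i \<mapsto> g i\<close>, extended by \<open>0\<close> to all strings that are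
  not in the range of the encoding \<open>enc\<close>. It is meaningful for injective \<open>enc\<close> only.\<close>

definition extend_zero :: "('i \<Rightarrow> bool list) \<Rightarrow> ('i \<Rightarrow> nat) \<Rightarrow> bool list \<Rightarrow> nat" where
  "extend_zero enc g x = (if x \<in> range enc then g (inv enc x) else 0)"

definition ones :: "nat \<Rightarrow> bool list" where
  "ones a = replicate a True"

lemma extend_zero_enc: "inj enc \<Longrightarrow> extend_zero enc g (enc i) = g i"
  by (simp add: extend_zero_def)

lemma inj_ones: "inj ones"
  by (auto simp: inj_def ones_def dest: arg_cong[of _ _ length])

lemma inj_ones_zero_ones: "inj (\<lambda>(n, k). ones n @ [False] @ ones k)"
proof (rule injI, clarify)
  fix n k n' k'
  assume eq: "ones n @ [False] @ ones k = ones n' @ [False] @ ones k'"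
  have *: "takeWhile id (ones i @ [False] @ ones j) = ones i" for i j
    by (induction i) (auto simp: ones_def)
  from eq have "ones n = ones n'"
    by (metis *)
  then have "n = n'"
    using inj_ones by (simp add: inj_eq)
  moreover have "n + k = n' + k'"
    using arg_cong[OF eq, of length] by (simp add: ones_def)
  ultimately show "n = n' \<and> k = k'"
    by simp
qed

end

theory Submission
  imports Defs "HOL-Library.Countable"
begin

text \<open>
  Put \<open>Z a b = E(a + b, a)\<close>. The Entringer recursion \<open>E(n, k + 1) = E(n, k) + E(n - 1, n - 1 - k)\<close>
  then reads \<open>Z (a + 1) b = Z a (b + 1) + Z b a\<close>, with \<open>Z 0 b = 1\<close> for \<open>b = 0\<close> and \<open>0\<close> otherwise
  (lemma \<open>zigzag_eq_entringer\<close>). Hence \<open>E(n, k)\<close> counts the successful runs of the following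
  process on two counters that starts with \<open>(a, b) = (k, n - k)\<close>: as long as \<open>a > 0\<close>, decrement \<open>a\<close>
  and then either increment \<open>b\<close> or exchange the roles of the two counters; if \<open>a = 0\<close>, accept if and
  only if \<open>b = 0\<close>. Both branches decrease \<open>(a + b, a)\<close> lexicographically, so every run ends, and
  \<open>a + b \<le> n\<close> at all times.

  A machine with a single work tape carries this out in logarithmic space. One counter is the
  distance of the input head from the right end marker, and the other one is kept in binary on the
  work tape. Exchanging the roles is a change of state: in the phase \<open>HeadTurn\<close> the input head holds
  \<open>a\<close>, in the phase \<open>TapeTurn\<close> the work tape does. The counters are easily loaded. A sweep to
  the right over \<open>1\<^sup>n 0 1\<^sup>k\<close> increments the tape counter \<open>n\<close> times and then decrements it \<open>k\<close> times, so
  that it ends as \<open>n - k\<close>. Now the head moves back to the \<open>0\<close> and one cell to the right, where its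
  distance from the right end marker is \<open>k\<close>. For the input \<open>1\<^sup>n\<close> the sweep does not touch the tape
  counter, and the way back ends next to the left end marker, with the counters \<open>(n, 0)\<close>; this
  yields \<open>E(n, n) = E\<^sub>n\<close>.

  The correctness proof goes backwards from the halting configurations along the predicate
  \<open>computes\<close>, which bundles the space bound, termination and the number of accepting paths. Its core
  is lemma \<open>run_turns\<close>, an induction along the recursion for \<open>Z\<close>.
\<close>


section \<open>Counting the accepting paths below a configuration\<close>

text \<open>
  \<open>computes M x m c v\<close>: from the configuration \<open>c\<close> on, the machine stays within the first \<open>m\<close> work
  cells, halts on every path, and has exactly \<open>v\<close> accepting paths. As an inductive predicate it is
  the well-founded recursion over the computation tree below \<open>c\<close>.
\<close>

inductive computes ::
    "('q, 'a) ntm \<Rightarrow> bool list \<Rightarrow> nat \<Rightarrow> ('q, 'a) config \<Rightarrow> nat \<Rightarrow> bool"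
  for M x m where
  halt: "halted M x c \<Longrightarrow> work_pos c < m \<Longrightarrow>
    computes M x m c (of_bool (state c \<in> accept M))"
| branch: "{c'. step M x c c'} = S \<Longrightarrow> finite S \<Longrightarrow> S \<noteq> {} \<Longrightarrow> work_pos c < m \<Longrightarrow>
    (\<And>c'. c' \<in> S \<Longrightarrow> computes M x m c' (f c')) \<Longrightarrow> computes M x m c (sum f S)"

lemma computes_reachable:
  assumes "(step M x)\<^sup>*\<^sup>* c c'" "computes M x m c v"
  shows "\<exists>v'. computes M x m c' v'"
  using assms
proof (induction arbitrary: v rule: converse_rtranclp_induct)
  case (step c c'')
  from step.prems step.hyps(1) have "\<exists>v'. computes M x m c'' v'"
    by (cases rule: computes.cases) (auto simp: halted_def)
  then show ?case using step.IH by blast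
qed blast

lemma computes_work_pos: "computes M x m c v \<Longrightarrow> work_pos c < m"
  by (erule computes.cases) auto

lemma computes_no_infinite_path:
  assumes "computes M x m c v" "r 0 = c" "\<And>i. step M x (r i) (r (Suc i))"
  shows False
  using assms
proof (induction arbitrary: r)
  case (halt c)
  then show ?case by (metis halted_def)
next
  case (branch c S f)
  have "r (Suc 0) \<in> S"
    using branch.hyps(1) branch.prems by (metis mem_Collect_eq)
  from branch.IH[OF this, of "\<lambda>i. r (Suc i)"] branch.prems show ?case by simp
qed

text \<open>The accepting paths that start in \<open>c\<close> instead of the initial configuration.\<close>

definition accepting_from ::
    "('q, 'a) ntm \<Rightarrow> bool list \<Rightarrow> ('q, 'a) config \<Rightarrow> ('q, 'a) config list set" where
  "accepting_from M x c =
     {cs. cs \<noteq> [] \<and> hd cs = c \<and> successively (step M x) cs \<and>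
          halted M x (last cs) \<and> state (last cs) \<in> accept M}"

lemma accepting_from_halted:
  assumes "halted M x c"
  shows "accepting_from M x c = (if state c \<in> accept M then {[c]} else {})"
proof -
  have "cs = [c]" if "cs \<in> accepting_from M x c" for cs
  proof -
    from that obtain cs' where cs: "cs = c # cs'"
      by (cases cs) (auto simp: accepting_from_def)
    then show ?thesis
      using that assms
      by (cases cs') (auto simp: accepting_from_def halted_def)
  qed
  moreover have "[c] \<in> accepting_from M x c \<longleftrightarrow> state c \<in> accept M"
    using assms by (simp add: accepting_from_def)
  ultimately show ?thesis by auto
qed

lemma accepting_from_branch:
  assumes "\<not> halted M x c"
  shows "accepting_from M x c = (\<Union>c' \<in> {c'. step M x c c'}. (#) c ` accepting_from M x c')"
proof (intro equalityI subsetI)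
  fix cs assume cs: "cs \<in> accepting_from M x c"
  then obtain cs' where cs': "cs = c # cs'"
    by (cases cs) (auto simp: accepting_from_def)
  with cs assms have "cs' \<noteq> []"
    by (auto simp: accepting_from_def)
  with cs cs' show "cs \<in> (\<Union>c' \<in> {c'. step M x c c'}. (#) c ` accepting_from M x c')"
    by (auto simp: accepting_from_def successively_Cons intro!: exI[of _ "hd cs'"])
qed (auto simp: accepting_from_def successively_Cons)

lemma computes_card:
  assumes "computes M x m c v"
  shows "finite (accepting_from M x c) \<and> card (accepting_from M x c) = v"
  using assms
proof induction
  case (halt c)
  then show ?case by (simp add: accepting_from_halted)
next
  case (branch c S f)
  have "\<not> halted M x c"
    using branch.hyps by (auto simp: halted_def)
  then have eq: "accepting_from M x c = (\<Union>c' \<in> S. (#) c ` accepting_from M x c')"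
    using branch.hyps(1) by (simp add: accepting_from_branch)
  have "card (\<Union>c' \<in> S. (#) c ` accepting_from M x c') =
      (\<Sum>c' \<in> S. card ((#) c ` accepting_from M x c'))"
    by (rule card_UN_disjoint) (use branch in \<open>auto simp: accepting_from_def\<close>)
  also have "\<dots> = sum f S"
    by (rule sum.cong) (use branch.IH in \<open>auto simp: card_image\<close>)
  finally show ?case
    using eq branch by auto
qed


section \<open>Renaming states and symbols\<close>

text \<open>
  The class \<^term>\<open>sharpL\<close> asks for natural numbers as states and symbols. Machines over arbitrary
  finite types are transferred along injections into the natural numbers.
\<close>

definition relabel :: "('q \<Rightarrow> 'r) \<Rightarrow> ('a \<Rightarrow> 'b) \<Rightarrow> ('q, 'a) ntm \<Rightarrow> ('r, 'b) ntm" where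
  "relabel h g M =
     \<lparr>states = h ` states M, symbols = g ` symbols M, blank = g (blank M),
      start = h (start M), accept = h ` accept M,
      trans_rel = (\<lambda>(q, a, b, q', b', d, e). (h q, a, g b, h q', g b', d, e)) ` trans_rel M\<rparr>"

lemma init_config_relabel: "init_config (relabel h g M) = map_config h g (init_config M)"
  by (simp add: init_config_def relabel_def comp_def)

lemma wf_relabel: "wf_ntm M \<Longrightarrow> wf_ntm (relabel h g M)"
  unfolding wf_ntm_def relabel_def by (fastforce simp: subset_iff)

text \<open>Equality of the successor sets is needed rather than a mere simulation: a renamed
  configuration must not have successors that are not renamed ones.\<close>

lemma step_relabel:
  assumes "inj h" "inj g"
  shows "{c''. step (relabel h g M) x (map_config h g c) c''} =
    map_config h g ` {c'. step M x c c'}"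
proof (intro equalityI subsetI)
  fix c'' assume "c'' \<in> {c''. step (relabel h g M) x (map_config h g c) c''}"
  then have "step (relabel h g M) x (map_config h g c) c''" by simp
  then show "c'' \<in> map_config h g ` {c'. step M x c c'}"
  proof cases
    case (1 q i t p q' b d e)
    from 1(1) obtain q0 t0 where c: "c = Config q0 i t0 p" "q = h q0" "t = g \<circ> t0"
      by (cases c) auto
    from 1(3) c obtain q1 b1 where
      tr: "(q0, read_input x i, t0 p, q1, b1, d, e) \<in> trans_rel M" "q' = h q1" "b = g b1"
      using assms by (auto simp: relabel_def inj_eq)
    from step.intros[where t = t0 and p = p, OF tr(1)]
    have "step M x c (Config q1 (min (length x + 1) (move d i)) (t0(p := b1)) (move e p))"
      using c by simp
    moreover have "c'' = map_config h g
        (Config q1 (min (length x + 1) (move d i)) (t0(p := b1)) (move e p))"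
      using 1 c tr by (auto simp: fun_eq_iff)
    ultimately show ?thesis by blast
  qed
next
  fix c'' assume "c'' \<in> map_config h g ` {c'. step M x c c'}"
  then obtain c' where c': "step M x c c'" "c'' = map_config h g c'" by blast
  from c'(1) show "c'' \<in> {c''. step (relabel h g M) x (map_config h g c) c''}"
  proof cases
    case (1 q i t p q' b d e)
    have "(h q, read_input x i, (g \<circ> t) p, h q', g b, d, e) \<in> trans_rel (relabel h g M)"
      using 1(3) by (force simp: relabel_def)
    from step.intros[where t = "g \<circ> t" and p = p, OF this] show ?thesis
      using 1 c' by (simp add: fun_upd_comp)
  qed
qed

lemma computes_relabel:
  assumes "computes M x m c v" and inj: "inj h" "inj g"
  shows "computes (relabel h g M) x m (map_config h g c) v"
  using assms(1)
proof induction
  case (halt c)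
  then have "halted (relabel h g M) x (map_config h g c)"
    using step_relabel[OF inj, of M x c] by (auto simp: halted_def)
  moreover have "state (map_config h g c) \<in> accept (relabel h g M) \<longleftrightarrow> state c \<in> accept M"
    using inj by (cases c) (auto simp: relabel_def inj_eq)
  moreover have "work_pos (map_config h g c) = work_pos c"
    by (cases c) simp
  ultimately show ?case
    using computes.halt[of "relabel h g M" x "map_config h g c" m] halt by simp
next
  case (branch c S f)
  have inj_map: "inj (map_config h g)"
    using inj by (rule config.inj_map)
  have "computes (relabel h g M) x m (map_config h g c)
      (sum (f \<circ> inv (map_config h g)) (map_config h g ` S))"
  proof (rule computes.branch)
    show "{c'. step (relabel h g M) x (map_config h g c) c'} = map_config h g ` S"
      using step_relabel[OF inj] branch.hyps by simp
    show "work_pos (map_config h g c) < m"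
      using branch.hyps by (cases c) simp
  qed (use branch inj_map in auto)
  moreover have "sum (f \<circ> inv (map_config h g)) (map_config h g ` S) = sum f S"
    using inj_map by (subst sum.reindex) (auto simp: inj_on_def)
  ultimately show ?case by simp
qed

lemma sharpL_I:
  fixes M :: "('q :: finite, 'a :: finite) ntm"
  assumes wf: "wf_ntm M"
    and bound: "(\<lambda>n. real (s n)) \<in> O(\<lambda>n. ln (real n))"
    and computes: "\<And>x. computes M x (s (length x)) (init_config M) (f x)"
  shows "f \<in> sharpL"
proof -
  define N :: "(nat, nat) ntm" where "N = relabel to_nat to_nat M"
  have N: "computes N x (s (length x)) (init_config N) (f x)" for x
    unfolding N_def init_config_relabel by (intro computes_relabel computes) auto
  have "accepting_paths N x = accepting_from N x (init_config N)" for x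
    by (simp add: accepting_paths_def accepting_from_def)
  then have "f x = card (accepting_paths N x)" for x
    using computes_card[OF N, of x] by simp
  moreover have "halts_on_every_path N x" for x
    using computes_no_infinite_path[OF N[of x]] by (auto simp: halts_on_every_path_def)
  moreover have "work_space_le N x (s (length x))" for x
    unfolding work_space_le_def using computes_reachable N computes_work_pos by metis
  moreover have "wf_ntm N"
    unfolding N_def by (rule wf_relabel[OF wf])
  ultimately show ?thesis
    unfolding sharpL_def using bound by blast
qed


section \<open>The machine\<close>

text \<open>
  In the phase \<open>Skip\<close> the machine passes over an input \<open>1\<^sup>n\<close>; in the phases \<open>Load\<close> and \<open>Unload\<close> it
  reads the \<open>1\<^sup>n\<close> and the \<open>1\<^sup>k\<close> of an input \<open>1\<^sup>n 0 1\<^sup>k\<close>; in the phase \<open>Back\<close> it moves the input head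
  from the right end to the first cell of the final block of ones. \<open>HeadTurn\<close> and \<open>TapeTurn\<close> are the
  two phases of the counter process.

  In the state \<open>At p\<close> the work head is on the marked cell \<open>0\<close>. The tape counter follows from cell \<open>1\<close>
  on, least significant digit first. \<open>Inc p\<close> carries to the right, and \<open>Return p\<close> brings the head
  back; \<open>Dec p\<close> looks for the lowest digit \<open>1\<close>, and \<open>Borrow p\<close> turns the zeros below it
  into ones on the way back. Both then continue with \<open>At p\<close>.
\<close>

datatype phase = Skip | Load | Unload | Back | HeadTurn | TapeTurn

datatype mstate = Start phase | At phase | Inc phase | Return phase | Dec phase | Borrow phase
  | Check | Accept

datatype sym = Blank | Mark | Digit bool

instance phase :: finite
proof
  have "(UNIV :: phase set) = {Skip, Load, Unload, Back, HeadTurn, TapeTurn}"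
    using phase.exhaust by blast
  then show "finite (UNIV :: phase set)" by (metis finite.simps)
qed

instance mstate :: finite
proof
  have "s \<in> range Start \<union> range At \<union> range Inc \<union> range Return \<union> range Dec \<union> range Borrow \<union>
      {Check, Accept}" for s
    by (cases s) auto
  then show "finite (UNIV :: mstate set)"
    by (rule finite_subset[OF subsetI]) simp
qed

instance sym :: finite
proof
  have "a \<in> range Digit \<union> {Blank, Mark}" for a
    by (cases a) auto
  then show "finite (UNIV :: sym set)"
    by (rule finite_subset[OF subsetI]) simp
qed

text \<open>
  The only branchings are those of the counter process, after \<open>a\<close> has been decremented. If \<open>a\<close> is on
  the tape, the branching takes place as soon as \<open>Dec TapeTurn\<close> meets a digit \<open>1\<close>: the next phase
  is \<open>TapeTurn\<close>, with the input head moved to the left (\<open>b\<close> incremented), or \<open>HeadTurn\<close>. If it meets the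
  blank instead, then \<open>a = 0\<close>. A zero of the tape counter in the phase \<open>Unload\<close> means \<open>k > n\<close>, and the
  machine halts without accepting.
\<close>

fun delta :: "mstate \<Rightarrow> insym \<Rightarrow> sym \<Rightarrow> (mstate \<times> sym \<times> dir \<times> dir) set" where
  "delta (Start p) a b = {(At p, Mark, MoveRight, Stay)}"
| "delta (At Skip) a b =
    (if a = Bit True then {(At Skip, b, MoveRight, Stay)}
     else if a = RightEnd then {(At Back, b, Stay, Stay)} else {})"
| "delta (At Load) a b =
    (if a = Bit True then {(Inc Load, b, MoveRight, MoveRight)}
     else if a = Bit False then {(At Unload, b, MoveRight, Stay)} else {})"
| "delta (At Unload) a b =
    (if a = Bit True then {(Dec Unload, b, MoveRight, MoveRight)}
     else if a = RightEnd then {(At Back, b, Stay, Stay)} else {})"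
| "delta (At Back) a b =
    (if a = Bit True \<or> a = RightEnd then {(At Back, b, MoveLeft, Stay)}
     else {(At HeadTurn, b, MoveRight, Stay)})"
| "delta (At HeadTurn) a b =
    (if a = RightEnd then {(Check, b, Stay, MoveRight)}
     else {(Inc HeadTurn, b, MoveRight, MoveRight), (At TapeTurn, b, MoveRight, Stay)})"
| "delta (At TapeTurn) a b = {(Dec TapeTurn, b, Stay, MoveRight)}"
| "delta (Inc p) a b =
    (if b = Digit True then {(Inc p, Digit False, Stay, MoveRight)}
     else {(Return p, Digit True, Stay, MoveLeft)})"
| "delta (Return p) a b =
    (if b = Mark then {(At p, b, Stay, Stay)} else {(Return p, b, Stay, MoveLeft)})"
| "delta (Dec p) a b =
    (if b = Digit False then {(Dec p, b, Stay, MoveRight)}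
     else if b = Digit True then
       (if p = TapeTurn
        then {(Borrow TapeTurn, Digit False, MoveLeft, MoveLeft),
              (Borrow HeadTurn, Digit False, Stay, MoveLeft)}
        else {(Borrow p, Digit False, Stay, MoveLeft)})
     else if p = TapeTurn \<and> a = RightEnd then {(Accept, b, Stay, Stay)} else {})"
| "delta (Borrow p) a b =
    (if b = Mark then {(At p, b, Stay, Stay)} else {(Borrow p, Digit True, Stay, MoveLeft)})"
| "delta Check a b =
    (if b = Digit False then {(Check, b, Stay, MoveRight)}
     else if b = Blank then {(Accept, b, Stay, Stay)} else {})"
| "delta Accept a b = {}"

text \<open>The initial phase is \<open>Skip\<close> for Euler numbers and \<open>Load\<close> for Entringer numbers.\<close>

definition zigzag_ntm :: "phase \<Rightarrow> (mstate, sym) ntm" where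
  "zigzag_ntm p =
     \<lparr>states = UNIV, symbols = UNIV, blank = Blank, start = Start p, accept = {Accept},
      trans_rel = {(q, a, b, t). t \<in> delta q a b}\<rparr>"

lemma wf_zigzag_ntm: "wf_ntm (zigzag_ntm p)"
  by (simp add: wf_ntm_def zigzag_ntm_def)

text \<open>The configuration reached from \<open>Config q i t p\<close> by the action that is the last argument; the
  state \<open>q\<close> has no influence on it.\<close>

definition succ_config ::
    "bool list \<Rightarrow> nat \<Rightarrow> (nat \<Rightarrow> sym) \<Rightarrow> nat \<Rightarrow> mstate \<times> sym \<times> dir \<times> dir \<Rightarrow> (mstate, sym) config"
  where
  "succ_config x i t p = (\<lambda>(q, b, d, e).
     Config q (min (length x + 1) (move d i)) (t(p := b)) (move e p))"

lemma step_zigzag_ntm: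
  "{c'. step (zigzag_ntm ph) x (Config q i t p) c'} =
     succ_config x i t p ` delta q (read_input x i) (t p)"
  by (force simp: step.simps zigzag_ntm_def succ_config_def)

text \<open>The tape counter never exceeds the input length \<open>n\<close>, so it has at most \<open>log 2 (2 n + 1)\<close>
  digits; the marked cell and one blank cell are added.\<close>

definition space :: "nat \<Rightarrow> nat" where
  "space n = nat \<lfloor>log 2 (real (2 * n + 1))\<rfloor> + 2"

lemma space_bigo: "(\<lambda>n. real (space n)) \<in> O(\<lambda>n. ln (real n))"
proof (rule bigoI)
  \<comment> \<open>For \<open>n \<ge> 2\<close>, \<open>log 2 (2 n + 1) \<le> 3 log 2 n\<close> and \<open>2 \<le> 2 log 2 n\<close>.\<close>
  show "\<forall>\<^sub>F n in sequentially. norm (real (space n)) \<le> (5 / ln 2) * norm (ln (real n))"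
  proof (rule eventually_sequentiallyI)
    fix n :: nat assume n: "2 \<le> n"
    have "real (space n) \<le> log 2 (real (2 * n + 1)) + 2"
      by (simp add: space_def)
    also have "log 2 (real (2 * n + 1)) \<le> log 2 (real n ^ 3)"
    proof -
      have "2 * n + 1 \<le> 4 * n" using n by simp
      also have "4 * n \<le> n ^ 3"
        using mult_mono[OF n n] by (simp add: power3_eq_cube)
      finally have "real (2 * n + 1) \<le> real n ^ 3"
        by (metis of_nat_le_iff of_nat_power)
      then show ?thesis using n by (subst log_le_cancel_iff) auto
    qed
    also have "log 2 (real n ^ 3) + 2 \<le> 5 * log 2 (real n)"
    proof -
      have "1 \<le> log 2 (real n)" using n by (simp add: le_log_iff)
      then show ?thesis using n by (simp add: log_nat_power)
    qed
    also have "\<dots> = (5 / ln 2) * norm (ln (real n))"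
      using n by (simp add: log_def)
    finally show "norm (real (space n)) \<le> (5 / ln 2) * norm (ln (real n))"
      by simp
  qed
qed

lemma less_space:
  assumes "2 ^ l \<le> 2 * n + (1::nat)"
  shows "Suc l < space n"
proof -
  have "real l = log 2 (2 ^ l)" by simp
  also have "\<dots> \<le> log 2 (real (2 * n + 1))"
    using assms by (subst log_le_cancel_iff) (auto simp flip: of_nat_le_iff[where ?'a = real])
  finally have "int l \<le> \<lfloor>log 2 (real (2 * n + 1))\<rfloor>"
    by (simp add: le_floor_iff)
  then show ?thesis by (simp add: space_def)
qed

section \<open>Binary counters on the work tape\<close>

text \<open>The work tape with the digits \<open>bs\<close>, the first of which is in cell \<open>1\<close>, between the marked
  cell \<open>0\<close> and the blanks.\<close>

definition tape :: "bool list \<Rightarrow> nat \<Rightarrow> sym" where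
  "tape bs j = (if j = 0 then Mark else if j \<le> length bs then Digit (bs ! (j - 1)) else Blank)"

text \<open>
  The digits \<open>bs\<close> represent \<open>c\<close>. Decrementing does not remove leading zeros, hence the number of
  digits is bounded in terms of the largest value \<open>n\<close> that the counter may have had, and not of \<open>c\<close>.
\<close>

definition counter :: "nat \<Rightarrow> nat \<Rightarrow> bool list \<Rightarrow> bool" where
  "counter n c bs \<longleftrightarrow> horner_sum of_bool 2 bs = c \<and> 2 ^ length bs \<le> 2 * n + 1"

text \<open>Binary increment, with the least significant digit first.\<close>

fun inc :: "bool list \<Rightarrow> bool list" where
  "inc [] = [True]"
| "inc (True # bs) = False # inc bs"
| "inc (False # bs) = True # bs"

lemma value_inc: "horner_sum of_bool 2 (inc bs) = horner_sum of_bool 2 bs + (1 :: nat)"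
  by (induction bs rule: inc.induct) auto

lemma length_inc:
  "length (inc bs) = length bs \<or>
   length (inc bs) = Suc (length bs) \<and> horner_sum of_bool 2 bs + (1 :: nat) = 2 ^ length bs"
  by (induction bs rule: inc.induct) auto

lemma counter_inc:
  assumes "counter n c bs" "c < n"
  shows "counter n (Suc c) (inc bs)"
  using assms length_inc[of bs] by (auto simp: counter_def value_inc)

lemma zeros_cases:
  obtains z where "bs = replicate z False"
  | z us where "bs = replicate z False @ True # us"
proof (cases "True \<in> set bs")
  case True
  then obtain vs us where "bs = vs @ True # us" "True \<notin> set vs"
    by (metis split_list_first)
  then show ?thesis using that(2)[of "length vs" us]
    by (metis (full_types) replicate_length_same)
next
  case False
  then show ?thesis using that(1)[of "length bs"]
    by (metis (full_types) replicate_length_same)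
qed

lemma value_zeros: "horner_sum of_bool 2 (replicate z False) = (0 :: nat)"
  by (induction z) auto

lemma value_dec: "horner_sum of_bool 2 (replicate z False @ True # us) =
    Suc (horner_sum of_bool 2 (replicate z True @ False # us))"
  by (induction z) auto

lemma counter_0:
  assumes "counter n 0 bs"
  obtains z where "bs = replicate z False"
  using assms by (cases bs rule: zeros_cases) (auto simp: counter_def value_dec)

lemma counter_Suc:
  assumes "counter n (Suc c) bs"
  obtains z us where "bs = replicate z False @ True # us"
    "counter n c (replicate z True @ False # us)"
  using assms by (cases bs rule: zeros_cases) (auto simp: counter_def value_dec value_zeros)

lemma tape_Blank [simp]: "tape bs (Suc (length bs)) = Blank"
  by (simp add: tape_def)

lemma tape_0 [simp]: "tape bs 0 = Mark"
  by (simp add: tape_def)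

lemma tape_Digit: "j < length bs \<Longrightarrow> tape bs (Suc j) = Digit (bs ! j)"
  by (simp add: tape_def)

lemma tape_append [simp]: "tape (us @ b # bs) (Suc (length us)) = Digit b"
  by (simp add: tape_def)

lemma tape_upd [simp]:
  "(tape (us @ b # bs))(Suc (length us) := Digit b') = tape (us @ b' # bs)"
  by (auto simp: tape_def fun_eq_iff nth_append nth_Cons split: nat.split)

lemma tape_upd_0 [simp]: "(tape bs)(0 := Mark) = tape bs"
  by (auto simp: tape_def fun_eq_iff)

lemma tape_upd_same: "j < length bs \<Longrightarrow> (tape bs)(Suc j := Digit (bs ! j)) = tape bs"
  by (auto simp: tape_def fun_eq_iff)

lemma tape_extend [simp]: "(tape bs)(Suc (length bs) := Digit b) = tape (bs @ [b])"
  by (auto simp: tape_def fun_eq_iff nth_append)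

lemma tape_Nil: "(\<lambda>_. Blank)(0 := Mark) = tape []"
  by (auto simp: tape_def fun_eq_iff)


section \<open>The zigzag recursion\<close>

text \<open>\<open>zigzag a b\<close> is the number of accepting runs of the counter process from \<open>(a, b)\<close>.\<close>

function zigzag :: "nat \<Rightarrow> nat \<Rightarrow> nat" where
  "zigzag 0 b = (if b = 0 then 1 else 0)"
| "zigzag (Suc a) b = zigzag a (Suc b) + zigzag b a"
  by pat_completeness auto
termination by (relation "measures [\<lambda>(a, b). a + b, fst]") auto


section \<open>Correctness of the machine\<close>

context
  fixes ph :: phase and x :: "bool list"
begin

text \<open>
  The lemmas below have the form of backward rules: the number of accepting paths of a configuration
  is obtained from those of the configurations that the machine reaches from it.
\<close>

abbreviation run :: "mstate \<Rightarrow> nat \<Rightarrow> (nat \<Rightarrow> sym) \<Rightarrow> nat \<Rightarrow> nat \<Rightarrow> bool" where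
  "run q i t p v \<equiv> computes (zigzag_ntm ph) x (space (length x)) (Config q i t p) v"

abbreviation cnt :: "nat \<Rightarrow> bool list \<Rightarrow> bool" where
  "cnt \<equiv> counter (length x)"

lemma run_halt:
  assumes "delta q (read_input x i) (t p) = {}" "p < space (length x)"
  shows "run q i t p (of_bool (q = Accept))"
proof -
  have "halted (zigzag_ntm ph) x (Config q i t p)"
    using step_zigzag_ntm[of ph x q i t p] assms by (auto simp: halted_def)
  then show ?thesis
    using computes.halt[of "zigzag_ntm ph" x "Config q i t p" "space (length x)"] assms
    by (simp add: zigzag_ntm_def)
qed

lemma run_det:
  assumes "delta q (read_input x i) (t p) = {(q', b, d, e)}" "p < space (length x)"
    "run q' (min (length x + 1) (move d i)) (t(p := b)) (move e p) v"
  shows "run q i t p v"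
proof -
  have "run q i t p (\<Sum>c \<in> succ_config x i t p ` delta q (read_input x i) (t p). v)"
    by (rule computes.branch[OF step_zigzag_ntm]) (use assms in \<open>auto simp: succ_config_def\<close>)
  then show ?thesis using assms(1) by simp
qed

lemma run_choice:
  assumes delta: "delta q (read_input x i) (t p) = {(q1, b1, d1, e1), (q2, b2, d2, e2)}"
    and "q1 \<noteq> q2" "p < space (length x)"
    and "run q1 (min (length x + 1) (move d1 i)) (t(p := b1)) (move e1 p) v1"
    and "run q2 (min (length x + 1) (move d2 i)) (t(p := b2)) (move e2 p) v2"
  shows "run q i t p (v1 + v2)"
proof -
  \<comment> \<open>The two successors are told apart by their states.\<close>
  let ?f = "\<lambda>c :: (mstate, sym) config. if state c = q1 then v1 else v2"
  have "run q i t p (sum ?f (succ_config x i t p ` delta q (read_input x i) (t p)))"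
    by (rule computes.branch[OF step_zigzag_ntm]) (use assms in \<open>auto simp: succ_config_def\<close>)
  then show ?thesis using assms(2) unfolding delta by (simp add: succ_config_def)
qed

lemma cnt_space: "cnt c bs \<Longrightarrow> Suc (length bs) < space (length x)"
  by (simp add: counter_def less_space)

lemma run_Return:
  assumes "run (At p) i (tape bs) 0 v" "j \<le> length bs" "length bs < space (length x)"
    "i \<le> length x + 1"
  shows "run (Return p) i (tape bs) j v"
  using assms(2)
proof (induction j)
  case 0
  show ?case by (rule run_det) (use assms in auto)
next
  case (Suc j)
  show ?case by (rule run_det) (use assms Suc in \<open>auto simp: tape_Digit tape_upd_same\<close>)
qed

lemma run_Inc_aux:
  assumes "run (At p) i (tape (us @ inc bs)) 0 v" "length (us @ inc bs) < space (length x)"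
    "i \<le> length x + 1"
  shows "run (Inc p) i (tape (us @ bs)) (Suc (length us)) v"
  using assms
proof (induction bs arbitrary: us rule: inc.induct)
  case 1
  have "run (Return p) i (tape (us @ [True])) (length us) v"
    by (rule run_Return) (use 1 in auto)
  then show ?case by - (rule run_det, use 1 in auto)
next
  case (2 bs)
  from "2.IH"[of "us @ [False]"] "2.prems" show ?case
    by - (rule run_det, auto)
next
  case (3 bs)
  have "run (Return p) i (tape (us @ True # bs)) (length us) v"
    by (rule run_Return) (use 3 in auto)
  then show ?case by - (rule run_det, use 3 in auto)
qed

lemma run_Inc:
  assumes "cnt c bs" "c < length x" "i \<le> length x + 1"
    "\<And>bs'. cnt (Suc c) bs' \<Longrightarrow> run (At p) i (tape bs') 0 v"
  shows "run (Inc p) i (tape bs) 1 v"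
  using run_Inc_aux[of p i "[]" bs v] assms counter_inc[OF assms(1,2)]
    cnt_space[of "Suc c" "inc bs"] by auto

lemma run_Borrow:
  assumes "run (At p) i (tape (replicate z True @ bs)) 0 v" "z + length bs < space (length x)"
    "i \<le> length x + 1"
  shows "run (Borrow p) i (tape (replicate z False @ bs)) z v"
  using assms
proof (induction z arbitrary: bs)
  case 0
  then show ?case by - (rule run_det, auto)
next
  case (Suc z)
  have 1: "tape (replicate (Suc z) False @ bs) = tape (replicate z False @ False # bs)"
    by (simp add: replicate_app_Cons_same)
  have "run (Borrow p) i (tape (replicate z False @ True # bs)) z v"
    by (rule Suc.IH) (use Suc.prems in \<open>auto simp: replicate_app_Cons_same\<close>)
  then show ?case
    unfolding 1 using Suc.prems tape_append[of "replicate z False" False bs]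
      tape_upd[of "replicate z False" False bs True]
    by - (rule run_det, auto)
qed

text \<open>Both \<open>Dec p\<close> and \<open>Check\<close> pass over the leading block of zero digits.\<close>

lemma run_scan:
  assumes "\<And>a. delta q a (Digit False) = {(q, Digit False, Stay, MoveRight)}"
    "run q i (tape (replicate z False @ bs)) (Suc z) v"
    "z + length bs < space (length x)" "i \<le> length x + 1"
  shows "run q i (tape (replicate z False @ bs)) 1 v"
proof -
  have "run q i (tape (replicate z False @ bs)) (Suc j) v" if "j \<le> z" for j
    using that
  proof (induction rule: inc_induct)
    case (step j)
    have "tape (replicate z False @ bs) (Suc j) = Digit False"
      using step.hyps by (simp add: tape_def nth_append)
    then show ?case
      by - (rule run_det[where b = "Digit False"],
        use assms step in \<open>auto simp: fun_upd_idem\<close>)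
  qed (use assms in simp)
  then show ?thesis by simp
qed

lemma run_Dec_0:
  assumes "cnt 0 bs" "i \<le> length x + 1"
  shows "run (Dec p) i (tape bs) 1 (of_bool (p = TapeTurn \<and> i = length x + 1))"
proof -
  from assms(1) obtain z where bs: "bs = replicate z False" by (rule counter_0)
  have s: "Suc z < space (length x)" using cnt_space[OF assms(1)] bs by simp
  have t: "tape bs (Suc z) = Blank" using tape_Blank[of bs] bs by simp
  have r: "read_input x i = RightEnd \<longleftrightarrow> i = length x + 1"
    using assms(2) by (auto simp: read_input_def)
  have "run (Dec p) i (tape bs) (Suc z) (of_bool (p = TapeTurn \<and> i = length x + 1))"
  proof (cases "p = TapeTurn \<and> i = length x + 1")
    case True
    have "run Accept i (tape bs) (Suc z) (of_bool (Accept = Accept))"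
      by (rule run_halt) (use s in auto)
    then show ?thesis
      by - (rule run_det, use True t s r in \<open>auto simp: fun_upd_idem\<close>)
  next
    case False
    have "run (Dec p) i (tape bs) (Suc z) (of_bool (Dec p = Accept))"
      by (rule run_halt) (use False t s r in auto)
    then show ?thesis unfolding False[THEN eq_False[THEN iffD2]] by simp
  qed
  then show ?thesis
    using run_scan[of "Dec p" i z "[]"] s assms bs by simp
qed

lemma run_Check:
  assumes "cnt c bs" "i \<le> length x + 1"
  shows "run Check i (tape bs) 1 (of_bool (c = 0))"
proof (cases c)
  case 0
  with assms obtain z where bs: "bs = replicate z False" using counter_0 by metis
  have s: "Suc z < space (length x)" using cnt_space[OF assms(1)] bs by simp
  have t: "tape bs (Suc z) = Blank" using tape_Blank[of bs] bs by simp
  have "run Accept i (tape bs) (Suc z) (of_bool (Accept = Accept))"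
    by (rule run_halt) (use s in auto)
  then have "run Check i (tape bs) (Suc z) 1"
    by - (rule run_det, use t s assms in \<open>auto simp: fun_upd_idem\<close>)
  then show ?thesis
    using run_scan[of Check i z "[]"] s assms bs 0 by simp
next
  case (Suc c')
  with assms obtain z us where bs: "bs = replicate z False @ True # us" using counter_Suc by metis
  have s: "Suc (z + length (True # us)) < space (length x)" using cnt_space[OF assms(1)] bs by simp
  have t: "tape bs (Suc z) = Digit True" using tape_append[of "replicate z False"] bs by simp
  have "run Check i (tape bs) (Suc z) (of_bool (Check = Accept))"
    by (rule run_halt) (use t s in auto)
  then show ?thesis
    using run_scan[of Check i z "True # us"] s assms bs Suc by simp
qed

text \<open>The common part of decrementing a positive counter in the phases \<open>Unload\<close> and \<open>TapeTurn\<close>: the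
  lowest digit \<open>1\<close> is in cell \<open>z + 1\<close>, and borrowing leads to the decremented counter.\<close>

lemma Dec_Suc_config:
  assumes "cnt (Suc c) bs"
  obtains z us where "bs = replicate z False @ True # us"
    "tape bs (Suc z) = Digit True"
    "Suc (z + length (True # us)) < space (length x)"
    "\<And>p i v. i \<le> length x + 1 \<Longrightarrow> (\<And>bs'. cnt c bs' \<Longrightarrow> run (At p) i (tape bs') 0 v) \<Longrightarrow>
       run (Borrow p) i ((tape bs)(Suc z := Digit False)) z v"
proof -
  from assms obtain z us where bs: "bs = replicate z False @ True # us"
    and c: "cnt c (replicate z True @ False # us)" by (rule counter_Suc)
  have s: "Suc (z + length (True # us)) < space (length x)"
    using cnt_space[OF assms] bs by simp
  show ?thesis
  proof (rule that[OF bs _ s])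
    show "tape bs (Suc z) = Digit True"
      using tape_append[of "replicate z False"] bs by simp
    fix p i v
    assume "i \<le> length x + 1" "\<And>bs'. cnt c bs' \<Longrightarrow> run (At p) i (tape bs') 0 v"
    then show "run (Borrow p) i ((tape bs)(Suc z := Digit False)) z v"
      using run_Borrow[of p i z "False # us" v] s c bs tape_upd[of "replicate z False" True us False]
      by auto
  qed
qed

lemma run_Dec_Unload:
  assumes "cnt (Suc c) bs" "i \<le> length x + 1"
    "\<And>bs'. cnt c bs' \<Longrightarrow> run (At Unload) i (tape bs') 0 v"
  shows "run (Dec Unload) i (tape bs) 1 v"
proof -
  from assms(1) obtain z us where *: "bs = replicate z False @ True # us"
    "tape bs (Suc z) = Digit True"
    "Suc (z + length (True # us)) < space (length x)"
    "\<And>p i v. i \<le> length x + 1 \<Longrightarrow> (\<And>bs'. cnt c bs' \<Longrightarrow> run (At p) i (tape bs') 0 v) \<Longrightarrow>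
       run (Borrow p) i ((tape bs)(Suc z := Digit False)) z v"
    by (rule Dec_Suc_config) blast
  have "run (Dec Unload) i (tape bs) (Suc z) v"
    by (rule run_det) (use *(2-4) assms in auto)
  then show ?thesis
    using run_scan[of "Dec Unload" i z "True # us" v] *(1,3) assms(2) by simp
qed

lemma run_Dec_TapeTurn:
  assumes "cnt (Suc c) bs" "i \<le> length x + 1"
    "\<And>bs'. cnt c bs' \<Longrightarrow> run (At TapeTurn) (i - 1) (tape bs') 0 v1"
    "\<And>bs'. cnt c bs' \<Longrightarrow> run (At HeadTurn) i (tape bs') 0 v2"
  shows "run (Dec TapeTurn) i (tape bs) 1 (v1 + v2)"
proof -
  from assms(1) obtain z us where *: "bs = replicate z False @ True # us"
    "tape bs (Suc z) = Digit True"
    "Suc (z + length (True # us)) < space (length x)"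
    "\<And>p i v. i \<le> length x + 1 \<Longrightarrow> (\<And>bs'. cnt c bs' \<Longrightarrow> run (At p) i (tape bs') 0 v) \<Longrightarrow>
       run (Borrow p) i ((tape bs)(Suc z := Digit False)) z v"
    by (rule Dec_Suc_config) blast
  have "run (Borrow TapeTurn) (i - 1) ((tape bs)(Suc z := Digit False)) z v1"
    "run (Borrow HeadTurn) i ((tape bs)(Suc z := Digit False)) z v2"
    by (rule *(4); use assms in simp)+
  then have "run (Dec TapeTurn) i (tape bs) (Suc z) (v1 + v2)"
    by - (rule run_choice, use *(2,3) assms(2) in auto)
  then show ?thesis
    using run_scan[of "Dec TapeTurn" i z "True # us" "v1 + v2"] *(1,3) assms(2) by simp
qed

text \<open>
  The machine performs the counter process. Since the two counters exchange their roles, the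
  statements for both phases are proved together.
\<close>

lemma run_turns:
  assumes "a + b \<le> length x"
  shows "cnt b bs \<Longrightarrow> run (At HeadTurn) (length x + 1 - a) (tape bs) 0 (zigzag a b)"
    and "cnt a bs \<Longrightarrow> run (At TapeTurn) (length x + 1 - b) (tape bs) 0 (zigzag a b)"
  using assms
proof (induction a b arbitrary: bs rule: zigzag.induct)
  case (1 b)
  {
    case 1
    have "run Check (length x + 1) (tape bs) 1 (of_bool (b = 0))"
      by (rule run_Check) (use 1 in auto)
    then show ?case
      by - (rule run_det[where b = Mark and d = Stay and e = MoveRight],
        use cnt_space[OF 1(1)] in \<open>auto simp: read_input_def fun_upd_idem of_bool_def\<close>)
  next
    case 2
    have "run (Dec TapeTurn) (length x + 1 - b) (tape bs) 1 (of_bool (b = 0))"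
    proof -
      have "length x + 1 - b = length x + 1 \<longleftrightarrow> b = 0" using 2(2) by auto
      with run_Dec_0[OF 2(1), of "length x + 1 - b" TapeTurn] show ?thesis by simp
    qed
    then show ?case
      by - (rule run_det[where b = Mark and d = Stay and e = MoveRight],
        use cnt_space[OF 2(1)] in \<open>auto simp: fun_upd_idem of_bool_def\<close>)
  }
next
  case (2 a b)
  {
    case 1
    have "run (Inc HeadTurn) (length x + 1 - a) (tape bs) 1 (zigzag a (Suc b))"
      by (rule run_Inc[OF 1(1)]) (use 1 "2.IH"(1) in auto)
    moreover have "run (At TapeTurn) (length x + 1 - a) (tape bs) 0 (zigzag b a)"
      by (rule "2.IH"(4)) (use 1 in auto)
    moreover have "min (length x + 1) (Suc (length x - a)) = length x + 1 - a"
      using 1 by auto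
    ultimately show ?case
      unfolding zigzag.simps
      by - (rule run_choice[where ?b1.0 = Mark and ?b2.0 = Mark and ?d1.0 = MoveRight
            and ?d2.0 = MoveRight and ?e1.0 = MoveRight and ?e2.0 = Stay],
        use 1 cnt_space[OF 1(1)] in \<open>auto simp: read_input_def fun_upd_idem\<close>)
  next
    case 2
    have "run (Dec TapeTurn) (length x + 1 - b) (tape bs) 1 (zigzag a (Suc b) + zigzag b a)"
    proof (rule run_Dec_TapeTurn[OF 2(1)])
      fix bs' assume bs': "cnt a bs'"
      have "length x + 1 - b - 1 = length x + 1 - Suc b" by simp
      then show "run (At TapeTurn) (length x + 1 - b - 1) (tape bs') 0 (zigzag a (Suc b))"
        using "2.IH"(2)[OF bs'] 2(2) by simp
      show "run (At HeadTurn) (length x + 1 - b) (tape bs') 0 (zigzag b a)"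
        using "2.IH"(3)[OF bs'] 2(2) by simp
    qed simp
    then show ?case
      unfolding zigzag.simps
      by - (rule run_det[where b = Mark and d = Stay and e = MoveRight],
        use cnt_space[OF 2(1)] in \<open>auto simp: fun_upd_idem\<close>)
  }
qed

lemma read_input_append: "x = us @ b # vs \<Longrightarrow> read_input x (Suc (length us)) = Bit b"
  by (simp add: read_input_def)

lemma read_input_end: "read_input x (Suc (length x)) = RightEnd"
  by (simp add: read_input_def)

lemma space_pos: "0 < space (length x)" "1 < space (length x)"
  by (simp_all add: space_def)

text \<open>The phase \<open>Back\<close> stops at \<open>0\<close> or at the left end marker, at position \<open>length us\<close>; the cell
  to its right has the distance \<open>k\<close> from the right end marker.\<close>

lemma run_Back:
  assumes x: "x = us @ ones k" and us: "us = [] \<or> \<not> last us"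
    and c: "cnt c bs" "k + c \<le> length x"
  shows "run (At Back) (length x + 1) (tape bs) 0 (zigzag k c)"
proof -
  have "run (At Back) (length us + j) (tape bs) 0 (zigzag k c)" if "j \<le> Suc k" for j
    using that
  proof (induction j)
    case 0
    have "read_input x (length us) = (if us = [] then LeftEnd else Bit False)"
      using us x by (cases us rule: rev_cases) (auto simp: read_input_def nth_append)
    moreover have "run (At HeadTurn) (length us + 1) (tape bs) 0 (zigzag k c)"
      using run_turns(1)[OF c(2,1)] x by (simp add: ones_def)
    ultimately show ?case
      by - (rule run_det[where b = Mark and d = MoveRight and e = Stay],
        use x space_pos in \<open>auto simp: fun_upd_idem\<close>)
  next
    case (Suc j)
    have "read_input x (length us + Suc j) = (if j = k then RightEnd else Bit True)"
      using Suc.prems x by (auto simp: read_input_def nth_append ones_def)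
    then show ?case
      by - (rule run_det[where b = Mark and d = MoveLeft and e = Stay],
        use x space_pos Suc in \<open>auto simp: fun_upd_idem ones_def\<close>)
  qed
  from this[of "Suc k"] show ?thesis using x by (simp add: ones_def)
qed

text \<open>The phase \<open>Unload\<close> reads the remaining input \<open>vs\<close>; the result \<open>v\<close> must be \<open>0\<close> if \<open>vs\<close> contains a
  \<open>0\<close> or more than \<open>c\<close> ones.\<close>

lemma run_Unload:
  assumes "x = us @ vs" "cnt c bs"
    "\<And>bs'. vs = ones (length vs) \<Longrightarrow> length vs \<le> c \<Longrightarrow> cnt (c - length vs) bs' \<Longrightarrow>
       run (At Back) (length x + 1) (tape bs') 0 v"
    "vs \<noteq> ones (length vs) \<or> c < length vs \<Longrightarrow> v = 0"
  shows "run (At Unload) (length us + 1) (tape bs) 0 v"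
  using assms
proof (induction vs arbitrary: us c bs)
  case Nil
  then show ?case
    by - (rule run_det[where b = Mark and d = Stay and e = Stay],
      use Nil space_pos read_input_end in \<open>auto simp: fun_upd_idem ones_def\<close>)
next
  case (Cons y vs)
  note r = read_input_append[OF Cons.prems(1)]
  show ?case
  proof (cases y)
    case False
    have "run (At Unload) (length us + 1) (tape bs) 0 (of_bool (At Unload = Accept))"
      by (rule run_halt) (use r False space_pos in auto)
    moreover have "v = 0" using Cons.prems(4) False by (simp add: ones_def)
    ultimately show ?thesis by simp
  next
    case True
    have "run (Dec Unload) (length us + 2) (tape bs) 1 v"
    proof (cases c)
      case 0
      then have "v = 0" using Cons.prems(4) by simp
      then show ?thesis using run_Dec_0[of bs "length us + 2" Unload] Cons.prems 0 by simp
    next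
      case (Suc c')
      show ?thesis
      proof (rule run_Dec_Unload)
        show "cnt (Suc c') bs" using Suc Cons.prems by simp
        fix bs' assume bs': "cnt c' bs'"
        show "run (At Unload) (length us + 2) (tape bs') 0 v"
          using Cons.IH[of "us @ [y]" c' bs'] bs' Cons.prems Suc True by (auto simp: ones_def)
      qed (use Cons.prems in simp)
    qed
    then show ?thesis
      by - (rule run_det[where b = Mark and d = MoveRight and e = MoveRight],
        use space_pos r True Cons.prems in \<open>auto simp: fun_upd_idem\<close>)
  qed
qed

lemma run_Load:
  assumes "x = ones n @ vs" "cnt n bs"
  shows "run (At Load) (n + 1) (tape bs) 0
    (extend_zero (\<lambda>(n, k). ones n @ [False] @ ones k)
       (\<lambda>(n, k). if k \<le> n then zigzag k (n - k) else 0) x)"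
    (is "run _ _ _ _ (extend_zero ?enc ?g x)")
  using assms
proof (induction vs arbitrary: n bs)
  case Nil
  have "False \<in> set (?enc q)" for q by (cases q) simp
  moreover have "False \<notin> set x" using Nil by (simp add: ones_def)
  ultimately have "x \<notin> range ?enc" by blast
  moreover have "run (At Load) (n + 1) (tape bs) 0 (of_bool (At Load = Accept))"
    by (rule run_halt) (use Nil space_pos in \<open>auto simp: read_input_def ones_def\<close>)
  ultimately show ?case by (simp add: extend_zero_def)
next
  case (Cons y vs)
  have [simp]: "length (ones n) = n" by (simp add: ones_def)
  have r: "read_input x (Suc n) = Bit y"
    using read_input_append[OF Cons.prems(1)] by simp
  have l: "n < length x" using Cons.prems by simp
  show ?case
  proof (cases y)
    case True
    have "x = ones (Suc n) @ vs"
      using Cons.prems True by (simp add: ones_def replicate_app_Cons_same)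
    note IH = Cons.IH[OF this]
    have "run (Inc Load) (n + 2) (tape bs) 1 (extend_zero ?enc ?g x)"
      by (rule run_Inc[OF Cons.prems(2)]) (use IH l in simp_all)
    then show ?thesis
      by - (rule run_det[where b = Mark and d = MoveRight and e = MoveRight],
        use space_pos r True l in \<open>auto simp: fun_upd_idem\<close>)
  next
    case False
    have x: "x = (ones n @ [False]) @ vs" using Cons.prems False by simp
    have enc: "extend_zero ?enc ?g x = ?g (n, k)" if "vs = ones k" for k
      using extend_zero_enc[OF inj_ones_zero_ones, of ?g "(n, k)"] x that by simp
    have "run (At Unload) (length (ones n @ [False]) + 1) (tape bs) 0 (extend_zero ?enc ?g x)"
    proof (rule run_Unload[OF x Cons.prems(2)])
      fix bs' assume vs: "vs = ones (length vs)" "length vs \<le> n" and bs': "cnt (n - length vs) bs'"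
      have "run (At Back) (length x + 1) (tape bs') 0 (zigzag (length vs) (n - length vs))"
        by (rule run_Back[of "ones n @ [False]"]) (use vs bs' x l in auto)
      then show "run (At Back) (length x + 1) (tape bs') 0 (extend_zero ?enc ?g x)"
        using enc[OF vs(1)] vs(2) by simp
    next
      assume *: "vs \<noteq> ones (length vs) \<or> n < length vs"
      show "extend_zero ?enc ?g x = 0"
      proof (cases "x \<in> range ?enc")
        case True
        \<comment> \<open>The block before the first \<open>0\<close> is determined by the word.\<close>
        then obtain n' k where x': "x = ones n' @ [False] @ ones k" by auto
        have *: "takeWhile id (ones i @ [False] @ ws) = ones i" for i ws
          by (induction i) (auto simp: ones_def)
        have "ones n' = ones n" using *[of n' "ones k"] *[of n vs] x x' by simp
        with x x' have "vs = ones k" by simp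
        with \<open>vs \<noteq> ones (length vs) \<or> n < length vs\<close> enc[of k] show ?thesis
          by (auto simp: ones_def)
      qed (simp add: extend_zero_def)
    qed
    then show ?thesis
      by - (rule run_det[where b = Mark and d = MoveRight and e = Stay],
        use space_pos r False l in \<open>auto simp: fun_upd_idem\<close>)
  qed
qed

lemma run_Skip:
  assumes "x = ones n @ vs"
  shows "run (At Skip) (n + 1) (tape []) 0 (extend_zero ones (\<lambda>n. zigzag n 0) x)"
  using assms
proof (induction vs arbitrary: n)
  case Nil
  then have x: "x = ones n" by simp
  have "run (At Back) (length x + 1) (tape []) 0 (zigzag n 0)"
    by (rule run_Back[of "[]"]) (use x in \<open>auto simp: counter_def ones_def\<close>)
  moreover have "extend_zero ones (\<lambda>n. zigzag n 0) x = zigzag n 0"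
    using extend_zero_enc[OF inj_ones] x by simp
  moreover have "length x = n" using x by (simp add: ones_def)
  ultimately show ?case
    by - (rule run_det[where b = Mark and d = Stay and e = Stay],
      use space_pos read_input_end in \<open>auto simp: fun_upd_idem\<close>)
next
  case (Cons y vs)
  have [simp]: "length (ones n) = n" by (simp add: ones_def)
  have r: "read_input x (Suc n) = Bit y"
    using read_input_append[OF Cons.prems(1)] by simp
  show ?case
  proof (cases y)
    case True
    have "x = ones (Suc n) @ vs"
      using Cons.prems True by (simp add: ones_def replicate_app_Cons_same)
    from Cons.IH[OF this] show ?thesis
      by - (rule run_det[where b = Mark and d = MoveRight and e = Stay],
        use space_pos r True Cons.prems in \<open>auto simp: fun_upd_idem\<close>)
  next
    case False
    have "False \<in> set x" using Cons.prems False by simp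
    then have "x \<notin> range ones" by (auto simp: ones_def)
    moreover have "run (At Skip) (n + 1) (tape []) 0 (of_bool (At Skip = Accept))"
      by (rule run_halt) (use r False space_pos in auto)
    ultimately show ?thesis by (simp add: extend_zero_def)
  qed
qed

lemma computes_init:
  assumes "run (At ph) 1 (tape []) 0 v"
  shows "computes (zigzag_ntm ph) x (space (length x)) (init_config (zigzag_ntm ph)) v"
proof -
  have "run (Start ph) 0 (\<lambda>_. Blank) 0 v"
    by (rule run_det) (use assms space_pos tape_Nil in auto)
  then show ?thesis by (simp add: init_config_def zigzag_ntm_def)
qed

end


section \<open>Entringer numbers satisfy the zigzag recursion\<close>

text \<open>
  Deleting the first letter \<open>k + 1\<close> of an alternating word of \<open>{1..n + 1}\<close> leaves a word that starts
  with an ascent; closing the gap in its values and complementing them yields an alternating word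
  of \<open>{1..n}\<close>. The map \<open>complement_skip n k\<close> undoes this on the letters: it is the decreasing bijection
  from \<open>{1..n}\<close> to \<open>{1..n + 1} - {k + 1}\<close>.
\<close>

definition complement_skip :: "nat \<Rightarrow> nat \<Rightarrow> nat \<Rightarrow> nat" where
  "complement_skip n k y = (if n < k + y then n + 1 - y else n + 2 - y)"

lemma complement_skip_less_iff:
  assumes "y \<in> {1..n}" "z \<in> {1..n}"
  shows "complement_skip n k y < complement_skip n k z \<longleftrightarrow> z < y"
  using assms by (auto simp: complement_skip_def)

lemma inj_on_complement_skip: "inj_on (complement_skip n k) {1..n}"
  by (rule inj_onI) (metis complement_skip_less_iff less_irrefl linorder_neqE_nat)

lemma image_complement_skip:
  assumes "k \<le> n"
  shows "complement_skip n k ` {1..n} = {1..n + 1} - {k + 1}"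
proof (rule card_subset_eq)
  show "complement_skip n k ` {1..n} \<subseteq> {1..n + 1} - {k + 1}"
    using assms by (auto simp: complement_skip_def)
  show "card (complement_skip n k ` {1..n}) = card ({1..n + 1} - {k + 1})"
    using assms by (subst card_image[OF inj_on_complement_skip]) simp
qed simp

text \<open>The condition on \<^term>\<open>hd v\<close> is the initial descent of the longer word.\<close>

lemma alternating_Cons_map:
  assumes v: "v \<noteq> []" "set v = {1..n}" and "k \<le> n"
  shows "alternating ((k + 1) # map (complement_skip n k) v) \<longleftrightarrow> alternating v \<and> n < k + hd v"
proof -
  have nth: "v ! i \<in> {1..n}" if "i < length v" for i
    using v(2) nth_mem[OF that] by simp
  have hd: "hd v \<in> {1..n}" using v by (metis hd_in_set)
  let ?w = "(k + 1) # map (complement_skip n k) v"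
  have "alternating ?w \<longleftrightarrow> complement_skip n k (hd v) < k + 1 \<and>
      (\<forall>i. Suc i < length v \<longrightarrow>
        (if odd i then complement_skip n k (v ! i) > complement_skip n k (v ! Suc i)
         else complement_skip n k (v ! i) < complement_skip n k (v ! Suc i)))"
    (is "?L \<longleftrightarrow> ?R")
  proof
    assume ?L
    then have *: "if even i then ?w ! i > ?w ! Suc i else ?w ! i < ?w ! Suc i"
      if "Suc i < Suc (length v)" for i
      using spec[OF \<open>?L\<close>[unfolded alternating_def], of i] that by simp
    show ?R
    proof (intro conjI allI impI)
      show "complement_skip n k (hd v) < k + 1" using *[of 0] v(1) by (simp add: hd_conv_nth)
      fix i assume "Suc i < length v"
      then show "if odd i then complement_skip n k (v ! i) > complement_skip n k (v ! Suc i)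
         else complement_skip n k (v ! i) < complement_skip n k (v ! Suc i)"
        using *[of "Suc i"] by (auto split: if_splits)
    qed
  next
    assume R: ?R
    show ?L unfolding alternating_def
    proof (intro allI impI)
      fix i assume i: "Suc i < length ?w"
      show "if even i then ?w ! i > ?w ! Suc i else ?w ! i < ?w ! Suc i"
      proof (cases i)
        case 0
        then show ?thesis using R v(1) by (simp add: hd_conv_nth)
      next
        case (Suc j)
        then show ?thesis using R i by auto
      qed
    qed
  qed
  also have "\<dots> \<longleftrightarrow> n < k + hd v \<and> alternating v"
    using nth complement_skip_less_iff[of _ n _ k] hd \<open>k \<le> n\<close>
    by (auto simp: alternating_def complement_skip_def[of n k "hd v"] Suc_lessD)
  finally show ?thesis by blast
qed

text \<open>As \<open>k\<close> grows by one, the right-hand side gains the words with first letter \<open>n - k\<close>, which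
  gives the recursion \<open>entringer_Suc\<close>. For \<open>k = n\<close> it counts all alternating words of \<open>{1..n}\<close>.\<close>

lemma entringer_eq_card_tail:
  assumes "0 < n" "k \<le> n"
  shows "entringer n k = card {v \<in> permutations_of_set {1..n}. alternating v \<and> n < k + hd v}"
    (is "_ = card ?V")
proof -
  let ?W = "{w \<in> permutations_of_set {1..n + 1}. hd w = k + 1 \<and> alternating w}"
  let ?F = "\<lambda>v. (k + 1) # map (complement_skip n k) v"
  have ne: "v \<noteq> []" if "v \<in> permutations_of_set {1..n}" for v
    using that assms by (auto simp: permutations_of_set_def)
  have "bij_betw ?F ?V ?W"
    unfolding bij_betw_def
  proof
    show "inj_on ?F ?V"
    proof (rule inj_onI)
      fix u v assume uv: "u \<in> ?V" "v \<in> ?V" "?F u = ?F v"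
      then have "set u \<union> set v = {1..n}" by (auto simp: permutations_of_set_def)
      then show "u = v"
        using uv(3) inj_on_complement_skip[of n k]
        by (metis list.inj_map_strong list.inject inj_on_map_eq_map)
    qed
    show "?F ` ?V = ?W"
    proof (intro equalityI subsetI)
      fix w assume "w \<in> ?F ` ?V"
      then obtain v where v: "v \<in> ?V" "w = ?F v" by blast
      then have "set v = {1..n}" "distinct v" by (auto simp: permutations_of_set_def)
      moreover have "{1..n + 1} = insert (k + 1) ({1..n + 1} - {k + 1})"
        using assms by auto
      ultimately show "w \<in> ?W"
        using v ne alternating_Cons_map[of v n k] image_complement_skip[of k n]
            inj_on_complement_skip[of n k] assms
        by (simp add: permutations_of_set_def distinct_map)
    next
      fix w assume w: "w \<in> ?W"
      then obtain u where u: "w = (k + 1) # u"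
        by (cases w) (auto simp: permutations_of_set_def)
      then have set_u: "set u = complement_skip n k ` {1..n}" and "distinct u"
        using w image_complement_skip[OF assms(2)] by (auto simp: permutations_of_set_def)
      define v where "v = map (inv_into {1..n} (complement_skip n k)) u"
      have map_v: "map (complement_skip n k) v = u"
        unfolding v_def using set_u by (auto simp: f_inv_into_f intro!: map_idI)
      have set_v: "set v = {1..n}"
        unfolding v_def using set_u inj_on_complement_skip[of n k]
        by (simp add: inv_into_image_cancel)
      have "distinct v"
        using \<open>distinct u\<close> map_v by (metis distinct_map)
      with set_v have v: "v \<in> permutations_of_set {1..n}" by (simp add: permutations_of_set_def)
      then show "w \<in> ?F ` ?V"
        using w u map_v alternating_Cons_map[OF ne[OF v] set_v assms(2)] by auto
    qed
  qed
  from bij_betw_same_card[OF this] show ?thesis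
    unfolding entringer_def by (rule sym)
qed

lemma euler_eq_entringer: "euler_number n = entringer n n"
proof (cases "n = 0")
  case True
  have "{w \<in> permutations_of_set {1..0}. alternating w} = {[]}"
    by (auto simp: alternating_def)
  moreover have "{w \<in> permutations_of_set {Suc 0}. hd w = Suc 0 \<and> alternating w} = {[Suc 0]}"
    by (auto simp: alternating_def permutations_of_set_singleton)
  ultimately show ?thesis using True by (simp add: euler_number_def entringer_def)
next
  case False
  have "hd v \<noteq> 0" if "v \<in> permutations_of_set {1..n}" for v
    using that False hd_in_set[of v] by (fastforce simp: permutations_of_set_def)
  then have "{v \<in> permutations_of_set {1..n}. alternating v \<and> n < n + hd v} =
      {v \<in> permutations_of_set {1..n}. alternating v}" by auto
  with entringer_eq_card_tail[of n n] False show ?thesis by (simp add: euler_number_def)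
qed

lemma entringer_zero: "entringer n 0 = (if n = 0 then 1 else 0)"
proof (cases "n = 0")
  case True
  have "{w \<in> permutations_of_set {1..0}. alternating w} = {[]}"
    by (auto simp: alternating_def)
  then show ?thesis using True euler_eq_entringer[of 0] by (simp add: euler_number_def)
next
  case False
  have "\<not> n < hd v" if "v \<in> permutations_of_set {1..n}" for v
    using that False hd_in_set[of v] by (fastforce simp: permutations_of_set_def)
  then have "{v \<in> permutations_of_set {1..n}. alternating v \<and> n < 0 + hd v} = {}" by auto
  with entringer_eq_card_tail[of n 0] False show ?thesis by (metis card.empty gr0I le0)
qed

lemma entringer_above:
  assumes "n < k"
  shows "entringer n k = 0"
proof -
  have "hd w \<noteq> k + 1" if "w \<in> permutations_of_set {1..n + 1}" for w
    using that assms hd_in_set[of w] by (fastforce simp: permutations_of_set_def)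
  then have "{w \<in> permutations_of_set {1..n + 1}. hd w = k + 1 \<and> alternating w} = {}" by blast
  then show ?thesis unfolding entringer_def by (metis card.empty)
qed

lemma entringer_Suc:
  assumes "k \<le> n"
  shows "entringer (Suc n) (Suc k) = entringer (Suc n) k + entringer n (n - k)"
proof -
  let ?P = "permutations_of_set {1..Suc n}"
  have "{v \<in> ?P. alternating v \<and> Suc n < Suc k + hd v} =
      {v \<in> ?P. alternating v \<and> Suc n < k + hd v} \<union>
      {v \<in> ?P. hd v = n - k + 1 \<and> alternating v}"
    using assms by auto
  moreover have "card \<dots> = card {v \<in> ?P. alternating v \<and> Suc n < k + hd v} +
      card {v \<in> ?P. hd v = n - k + 1 \<and> alternating v}"
    by (rule card_Un_disjoint) (use assms in auto)
  ultimately show ?thesis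
    using entringer_eq_card_tail[of "Suc n" "Suc k"] entringer_eq_card_tail[of "Suc n" k] assms
    by (simp add: entringer_def)
qed

lemma zigzag_eq_entringer: "zigzag a b = entringer (a + b) a"
proof (induction a b rule: zigzag.induct)
  case (1 b)
  then show ?case by (simp add: entringer_zero)
next
  case (2 a b)
  then show ?case using entringer_Suc[of a "a + b"] by (simp add: add.commute)
qed


section \<open>Membership in #L\<close>

theorem theorem3p26:
  "extend_zero (\<lambda>(n, k). ones n @ [False] @ ones k) (\<lambda>(n, k). entringer n k) \<in> sharpL
   \<and> (\<forall>n. euler_number n = entringer n n)
   \<and> extend_zero ones euler_number \<in> sharpL"
proof (intro conjI allI)
  show "euler_number n = entringer n n" for n by (rule euler_eq_entringer)
  have init: "counter n 0 []" for n by (simp add: counter_def)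
  have ent: "entringer n k = (if k \<le> n then zigzag k (n - k) else 0)" for n k
    by (simp add: zigzag_eq_entringer entringer_above)
  show "extend_zero (\<lambda>(n, k). ones n @ [False] @ ones k) (\<lambda>(n, k). entringer n k) \<in> sharpL"
    unfolding ent
  proof (rule sharpL_I[OF wf_zigzag_ntm space_bigo])
    show "computes (zigzag_ntm Load) x (space (length x)) (init_config (zigzag_ntm Load))
      (extend_zero (\<lambda>(n, k). ones n @ [False] @ ones k)
        (\<lambda>(n, k). if k \<le> n then zigzag k (n - k) else 0) x)" for x
      by (rule computes_init) (use run_Load[of x 0 x "[]" Load] init in \<open>simp add: ones_def\<close>)
  qed
  have "euler_number = (\<lambda>n. zigzag n 0)"
    by (simp add: fun_eq_iff euler_eq_entringer zigzag_eq_entringer)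
  moreover have "extend_zero ones (\<lambda>n. zigzag n 0) \<in> sharpL"
  proof (rule sharpL_I[OF wf_zigzag_ntm space_bigo])
    show "computes (zigzag_ntm Skip) x (space (length x)) (init_config (zigzag_ntm Skip))
      (extend_zero ones (\<lambda>n. zigzag n 0) x)" for x
      by (rule computes_init) (use run_Skip[of x 0 x Skip] in \<open>simp add: ones_def\<close>)
  qed
  ultimately show "extend_zero ones euler_number \<in> sharpL" by simp
qed

end
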